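(* Let $w\in A^+$ be primitive and let $n$ be the Nyldon word conjugate to $w$. Let $K=\lfloor\log_2(|w|)\rfloor+1$. Then for all sufficiently large $k$ (depending on $w$), the Nyldon factorization of $w^k$ has the form $(p_1,\dots,p_i,n,n,\dots,n,s_1,\dots,s_j)$ for some $i,j\ge 0$ and Nyldon words $p_1,\dots,p_i,s_1,\dots,s_j$, where the displayed consecutive run consists of $k-K$ copies of $n$.
   Context: $A=\{0,1,\dots,m\}$ ($m\ge 1$) is a finite alphabet ordered $0<1<\cdots<m$; $|w|$ is the length of $w$. The lexicographic order $<_{\text{lex}}$ on $A^*$: $u<_{\text{lex}}v$ if $u$ is a proper prefix of $v$, or there are a word $p$ and letters $i<j$ with $pi$ a prefix of $u$ and $pj$ a prefix of $v$. Nyldon words are defined recursively: a nonempty word $w$ is Nyldon if $w$ is a single letter, or $w$ cannot be written as $w=w_1w_2\cdots w_k$ with $k\ge 2$, each $w_i$ Nyldon, and $w_1\le_{\text{lex}}w_2\le_{\text{lex}}\cdots\le_{\text{lex}}w_k$. Every nonempty word has a unique Nyldon factorization, i.e. a unique expression $w=w_1\cdots w_k$ ($k\ge 1$) with the $w_i$ Nyldon and $w_1\le_{\text{lex}}\cdots\le_{\text{lex}}w_k$; every primitive word has exactly one Nyldon conjugate. A word is primitive if it is not $u^k$ for a word $u$ and $k\ge 2$; $x$ is a conjugate of $w$ if $w=uv$, $x=vu$. *)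

theory Defs
  imports Complex_Main "HOL-Library.List_Lexorder"
begin

text \<open>
  Words over \<open>{0, ..., m}\<close> are lists in \<^term>\<open>lists {0..m::nat}\<close>. The list order of
  \<^theory>\<open>HOL-Library.List_Lexorder\<close> is the lexicographic order in which proper prefixes are
  smaller, so \<^term>\<open>sorted ws\<close> says that the factors are lexicographically nondecreasing.
\<close>

definition word_power :: "'a list \<Rightarrow> nat \<Rightarrow> 'a list" where
  "word_power u k = concat (replicate k u)"

definition primitive_word :: "'a list \<Rightarrow> bool" where
  "primitive_word w \<longleftrightarrow> \<not> (\<exists>u k. k \<ge> 2 \<and> w = word_power u k)"

definition conjugate_word :: "'a list \<Rightarrow> 'a list \<Rightarrow> bool" where
  "conjugate_word x w \<longleftrightarrow> (\<exists>u v. w = u @ v \<and> x = v @ u)"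

lemma length_less_of_concat:
  assumes "length ws \<ge> 2" "\<forall>u\<in>set ws. u \<noteq> []" "x \<in> set ws"
  shows "length x < length (concat ws)"
proof -
  obtain as bs where ws: "ws = as @ x # bs"
    using assms(3) by (meson split_list)
  with assms(1) have "as \<noteq> [] \<or> bs \<noteq> []" by auto
  with assms(2) ws have "concat as \<noteq> [] \<or> concat bs \<noteq> []"
    by (cases as; cases bs) auto
  then show ?thesis using ws by auto
qed

text \<open>
  The condition \<^prop>\<open>u \<noteq> []\<close> on the factors is implied by their being Nyldon; it is present only to
  make the recursion well-founded, and is eliminated in \<open>nyldon_iff\<close>.
\<close>

context
  notes conj_cong [fundef_cong]
begin

function nyldon :: "nat list \<Rightarrow> bool" where
  "nyldon w \<longleftrightarrow> w \<noteq> [] \<and>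
     (length w = 1 \<or>
      \<not> (\<exists>ws. (length ws \<ge> 2 \<and> concat ws = w \<and> (\<forall>u\<in>set ws. u \<noteq> [])) \<and>
              (\<forall>u\<in>set ws. nyldon u) \<and> sorted ws))"
  by pat_completeness auto
termination
  by (relation "measure length") (auto intro: length_less_of_concat)

end

declare nyldon.simps [simp del]

lemma nyldon_iff:
  "nyldon w \<longleftrightarrow> w \<noteq> [] \<and>
     (length w = 1 \<or>
      \<not> (\<exists>ws. length ws \<ge> 2 \<and> concat ws = w \<and> (\<forall>u\<in>set ws. nyldon u) \<and> sorted ws))"
proof -
  have "u \<noteq> []" if "nyldon u" for u
    using that by (subst (asm) nyldon.simps) simp
  then show ?thesis
    by (subst nyldon.simps) metis
qed

definition nyldon_factorization :: "nat list \<Rightarrow> nat list list \<Rightarrow> bool" where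
  "nyldon_factorization w ws \<longleftrightarrow>
     ws \<noteq> [] \<and> concat ws = w \<and> (\<forall>u\<in>set ws. nyldon u) \<and> sorted ws"

end

theory Submission
  imports Defs
begin

text \<open>
  Write \<open>w = uv\<close> and \<open>n = vu\<close> with \<open>v\<close> nonempty, so that \<open>w\<^sup>k = u n\<^sup>k\<^sup>-\<^sup>1 v\<close>. The Nyldon factors of \<open>u\<close> do not
  exceed \<open>n\<close>, because a Nyldon word is greater than its proper Nyldon suffixes. It remains to find
  \<open>i\<close> with \<open>2\<^sup>i \<le> |n|\<close> such that \<open>n\<^sup>i v\<close> factors into Nyldon words that are all at least \<open>n\<close>.

  Run Lazard elimination on \<open>n\<close> and on \<open>n\<^sup>i v\<close> in parallel, starting with \<open>i = 0\<close>: the least block \<open>y\<close>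
  present is merged with the block before it. This gets stuck only when \<open>n\<^sup>i v\<close> begins with
  \<open>y\<close> while \<open>n\<close> does not; then a further copy of \<open>n\<close> is prepended, and \<open>i\<close> grows by one. Between two such
  events every block of \<open>n\<close> takes part in a merge, so the shortest block of \<open>n\<close> at
  least doubles in length.
\<close>

section \<open>Word order, overlaps and powers\<close>

lemma le_append_list: "x \<le> x @ (y :: 'a::linorder list)"
  by (induction x) auto

lemma less_append_list: "y \<noteq> [] \<Longrightarrow> x < x @ (y :: 'a::linorder list)"
  by (induction x) (auto simp: neq_Nil_conv)

lemma append_eq_append_suffix:
  "a @ b = c @ d \<Longrightarrow> length d \<le> length b \<Longrightarrow> \<exists>e. b = e @ d"
  by (auto simp: append_eq_append_conv2)

lemma append_eq_append_longer:
  "a @ b = c @ d \<Longrightarrow> \<not> length d \<le> length b \<Longrightarrow> \<exists>e. e \<noteq> [] \<and> d = e @ b \<and> a = c @ e"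
  by (auto simp: append_eq_append_conv2)

lemma word_power_Suc: "word_power u (Suc k) = u @ word_power u k"
  by (simp add: word_power_def)

section \<open>Nyldon factorizations, suffixes and products\<close>

lemma nyldon_not_Nil: "nyldon w \<Longrightarrow> w \<noteq> []"
  using nyldon_iff by blast

lemma nyldon_singleton: "nyldon [a]"
  by (subst nyldon_iff) simp

lemma nyldon_concat_sorted:
  assumes "nyldon (concat ws)" "\<forall>u\<in>set ws. nyldon u" "sorted ws"
  shows "length ws = 1"
proof -
  have "ws \<noteq> []" using assms(1) nyldon_not_Nil by fastforce
  moreover have "\<not> length ws \<ge> 2"
  proof
    assume len: "length ws \<ge> 2"
    have "\<forall>u\<in>set ws. u \<noteq> []" using assms(2) nyldon_not_Nil by blast
    then have pos: "1 \<le> length u" if "u \<in> set ws" for u using that by (simp add: Suc_leI)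
    obtain a where a: "a \<in> set ws" using \<open>ws \<noteq> []\<close> by (meson hd_in_set)
    have "length a < length (concat ws)"
      using length_less_of_concat len \<open>\<forall>u\<in>set ws. u \<noteq> []\<close> a by blast
    then have "length (concat ws) \<noteq> 1" using pos[OF a] by linarith
    then show False using assms len nyldon_iff[of "concat ws"] by blast
  qed
  ultimately show ?thesis by (metis One_nat_def Suc_1 length_0_conv less_2_cases not_less)
qed

lemma nyldon_factorization_exists:
  assumes "w \<noteq> []" shows "\<exists>ws. nyldon_factorization w ws"
proof (cases "nyldon w")
  case True
  then show ?thesis by (intro exI[of _ "[w]"]) (simp add: nyldon_factorization_def)
next
  case False
  then obtain ws where "length ws \<ge> 2" "concat ws = w" "\<forall>u\<in>set ws. nyldon u" "sorted ws"
    using nyldon_iff[of w] assms by blast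
  then show ?thesis unfolding nyldon_factorization_def by (intro exI[of _ ws]) auto
qed

lemma nyldon_factorization_snoc:
  assumes "w \<noteq> []"
  obtains ws g where "nyldon_factorization w (ws @ [g])"
  using nyldon_factorization_exists[OF assms] by (metis nyldon_factorization_def rev_exhaust)

text \<open>The last Nyldon factor of \<open>s\<close> is a suffix of \<open>s\<close>, so at most
  \<open>hd gs\<close>; the factors of \<open>s\<close> followed by \<open>gs\<close> would split a
  Nyldon word into at least two nondecreasing factors.\<close>

lemma nyldon_suffix_append_not_sorted:
  assumes "nyldon (s @ concat gs)" "s \<noteq> []" "gs \<noteq> []" "\<forall>g\<in>set gs. nyldon g" "sorted gs"
    and le: "\<And>p r. s = p @ r \<Longrightarrow> nyldon r \<Longrightarrow> r \<le> hd gs"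
  shows False
proof -
  obtain ws g where f: "nyldon_factorization s (ws @ [g])"
    using nyldon_factorization_snoc assms(2) by blast
  then have "s = concat ws @ g" "nyldon g" by (auto simp: nyldon_factorization_def)
  then have "g \<le> hd gs" using le by blast
  then have gs: "g \<le> h" if "h \<in> set gs" for h using assms(5) that by (cases gs) auto
  have "sorted ws" using f by (auto simp: nyldon_factorization_def sorted_append)
  moreover have ws: "u \<le> g" if "u \<in> set ws" for u
    using f that by (auto simp: nyldon_factorization_def sorted_append)
  ultimately have "sorted (ws @ [g] @ gs)"
    using assms(5) gs order_trans[OF ws gs] by (auto simp: sorted_append)
  moreover have "concat (ws @ [g] @ gs) = s @ concat gs" "\<forall>u\<in>set (ws @ [g] @ gs). nyldon u"
    using f assms(4) by (auto simp: nyldon_factorization_def)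
  ultimately have "length (ws @ [g] @ gs) = 1"
    using assms(1) by (metis nyldon_concat_sorted)
  then show False using assms(3) by simp
qed

text \<open>A longer Nyldon suffix would begin with a nonempty suffix \<open>s\<close> of an earlier
  factor \<open>a\<close>. Nyldon suffixes of \<open>s\<close> are at most \<open>a\<close>, hence
  at most the next factor, which the preceding lemma excludes. The suffix order is assumed only
  below the length of \<open>w\<close>, for use in the induction that proves it.\<close>

lemma last_factor_longest_aux:
  assumes less: "\<And>x p s. length x < length w \<Longrightarrow> nyldon x \<Longrightarrow> x = p @ s \<Longrightarrow> p \<noteq> [] \<Longrightarrow> nyldon s \<Longrightarrow> s < x"
    and "nyldon_factorization w (ws @ [g])" "w = p @ h" "nyldon h"
  shows "length h \<le> length g"
  using assms
proof (induction ws arbitrary: w p)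
  case Nil
  then show ?case by (simp add: nyldon_factorization_def)
next
  case (Cons a ws)
  note less = Cons.prems(1) and fac = Cons.prems(2) and w = Cons.prems(3) and h = Cons.prems(4)
  let ?v = "concat (ws @ [g])"
  have ny: "nyldon a" "\<forall>u\<in>set (ws @ [g]). nyldon u" and so: "sorted (a # ws @ [g])"
    and conc: "w = a @ ?v"
    using fac by (auto simp: nyldon_factorization_def)
  have "g \<noteq> []" "a \<noteq> []" using ny nyldon_not_Nil by auto
  show ?case
  proof (cases "length h \<le> length ?v")
    case True
    then obtain p' where p': "?v = p' @ h"
      using append_eq_append_suffix[of a ?v p h] conc w by metis
    show ?thesis
    proof (rule Cons.IH[OF _ _ p' h])
      show "nyldon_factorization ?v (ws @ [g])"
        using ny so by (auto simp: nyldon_factorization_def)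
      have "length ?v \<le> length w" using conc by simp
      then show "\<And>x p s. length x < length ?v \<Longrightarrow> nyldon x \<Longrightarrow> x = p @ s \<Longrightarrow> p \<noteq> [] \<Longrightarrow> nyldon s \<Longrightarrow> s < x"
        using less order_less_le_trans by blast
    qed
  next
    case False
    then obtain s where s: "h = s @ ?v" "a = p @ s" "s \<noteq> []"
      using append_eq_append_longer[of a ?v p h] conc w by force
    have "False"
    proof (rule nyldon_suffix_append_not_sorted[of s "ws @ [g]"])
      fix p' r assume r: "s = p' @ r" "nyldon r"
      have "length a < length w" using conc \<open>g \<noteq> []\<close> by simp
      then have "r \<le> a"
        using less[of a "p @ p'" r] r s(2) ny(1) by (cases "p @ p' = []") auto
      also have "a \<le> hd (ws @ [g])" using so by (cases ws) auto
      finally show "r \<le> hd (ws @ [g])" .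
    qed (use h s ny so in auto)
    then show ?thesis ..
  qed
qed

text \<open>Let \<open>l\<close> be the longest proper Nyldon suffix and \<open>w = x @ l\<close>;
  shorter ones are suffixes of \<open>l\<close>, covered by induction. The last factor
  \<open>g\<close> of \<open>x\<close> exceeds \<open>l\<close>, as otherwise \<open>w\<close> would
  factor. If \<open>x\<close> had further factors, maximality would make \<open>l\<close> the last
  factor of \<open>g @ l\<close>, whence \<open>g \<le> l\<close>. So \<open>x = g\<close> and
  \<open>l < g \<le> w\<close>.\<close>

lemma nyldon_suffix_less:
  assumes "nyldon w" "w = p @ s" "p \<noteq> []" "nyldon s"
  shows "s < w"
  using assms
proof (induction w arbitrary: p s rule: length_induct)
  case (1 w)
  have less: "length x < length w \<Longrightarrow> nyldon x \<Longrightarrow> x = p @ s \<Longrightarrow> p \<noteq> [] \<Longrightarrow> nyldon s \<Longrightarrow> s < x"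
    for x p s using 1(1) by blast
  let ?P = "\<lambda>s. nyldon s \<and> (\<exists>p. w = p @ s \<and> p \<noteq> [])"
  have "?P s" using 1 by blast
  moreover have "\<forall>s. ?P s \<longrightarrow> length s < Suc (length w)" by auto
  ultimately obtain l where l: "?P l" and max: "\<And>s. ?P s \<Longrightarrow> length s \<le> length l"
    using ex_has_greatest_nat[of ?P s length "Suc (length w)"] by blast
  then obtain x where x: "w = x @ l" "x \<noteq> []" "nyldon l" by blast
  obtain ws g where f: "nyldon_factorization x (ws @ [g])"
    using nyldon_factorization_snoc x by blast
  have g: "nyldon g" "x = concat ws @ g" and ws: "\<forall>u\<in>set ws. nyldon u" and so: "sorted (ws @ [g])"
    using f by (auto simp: nyldon_factorization_def)
  have gl: "l < g"
  proof (rule ccontr)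
    assume "\<not> l < g"
    then have "sorted ((ws @ [g]) @ [l])" using so
      by (subst sorted_append) (fastforce simp: sorted_append)
    moreover have "concat ((ws @ [g]) @ [l]) = w" "\<forall>u\<in>set ((ws @ [g]) @ [l]). nyldon u"
      using x g ws by simp_all
    ultimately have "length ((ws @ [g]) @ [l]) = 1"
      using 1(2) by (metis nyldon_concat_sorted)
    then show False by simp
  qed
  have "ws = []"
  proof (rule ccontr)
    assume "ws \<noteq> []"
    then have ne: "concat ws \<noteq> []" using ws nyldon_not_Nil by (cases ws) auto
    have len: "length (g @ l) < length w" using x(1) g(2) ne by simp
    have "\<not> nyldon (g @ l)"
    proof
      assume "nyldon (g @ l)"
      then have "length (g @ l) \<le> length l" using max[of "g @ l"] x(1) g(2) ne by auto
      then show False using g(1) nyldon_not_Nil by simp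
    qed
    obtain vs h where vs: "nyldon_factorization (g @ l) (vs @ [h])"
      using nyldon_factorization_snoc[of "g @ l"] nyldon_not_Nil[OF g(1)] by blast
    have vsh: "g @ l = concat vs @ h" "nyldon h" "\<forall>u\<in>set vs. nyldon u" "sorted (vs @ [h])"
      using vs by (auto simp: nyldon_factorization_def)
    have "length l \<le> length h"
      using last_factor_longest_aux[OF _ vs, of g l] less len x(3) by (meson less_trans)
    moreover have "length h \<le> length l"
      using max[of h] vsh(1,2) x(1) g(2) ne by auto
    ultimately have "h = l" "concat vs = g" using vsh(1) by auto
    moreover have "length vs = 1"
      using nyldon_concat_sorted[of vs] g(1) vsh \<open>concat vs = g\<close> by (auto simp: sorted_append)
    ultimately have "g \<le> l" using vsh(4) by (cases vs) auto
    then show False using gl by simp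
  qed
  then have "l < w" using gl g(2) x(1) le_append_list[of g l] by simp
  moreover have "s \<le> l"
  proof (cases "s = l")
    case False
    have "length s \<le> length l" using max[of s] 1 by blast
    then obtain p' where p': "l = p' @ s" using 1(3) x(1) by (auto simp: append_eq_append_conv2)
    moreover have "length l < length w" using x by simp
    ultimately show ?thesis using less[of l p' s] x(3) 1(5) False by force
  qed simp
  ultimately show ?case by simp
qed

lemma last_factor_longest:
  assumes "nyldon_factorization w (ws @ [g])" "w = p @ h" "nyldon h"
  shows "length h \<le> length g"
  using last_factor_longest_aux[OF _ assms] nyldon_suffix_less by blast

lemma nyldon_append_suffix_not_nyldon:
  assumes "nyldon y" "s \<noteq> []" and "\<And>p r. s = p @ r \<Longrightarrow> nyldon r \<Longrightarrow> r \<le> y"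
  shows "\<not> nyldon (s @ y)"
  using nyldon_suffix_append_not_sorted[of s "[y]"] assms by auto

text \<open>The last factor of \<open>x @ y\<close> is its longest Nyldon suffix, so it is
  \<open>s @ y\<close> with \<open>s\<close> a suffix of \<open>x\<close>. An empty \<open>s\<close>
  forces \<open>x \<le> y\<close>; a nonempty proper \<open>s\<close> contradicts the preceding
  lemma.\<close>

lemma nyldon_append:
  assumes "nyldon x" "nyldon y" "y < x"
    and suf: "\<And>p s. x = p @ s \<Longrightarrow> p \<noteq> [] \<Longrightarrow> nyldon s \<Longrightarrow> s \<le> y"
  shows "nyldon (x @ y)"
proof -
  obtain gs g where f: "nyldon_factorization (x @ y) (gs @ [g])"
    using nyldon_factorization_snoc[of "x @ y"] nyldon_not_Nil[OF assms(1)] by blast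
  then have g: "x @ y = concat gs @ g" "nyldon g" "\<forall>u\<in>set gs. nyldon u" "sorted (gs @ [g])"
    by (auto simp: nyldon_factorization_def)
  have "length y \<le> length g" using last_factor_longest[OF f] assms(2) by blast
  then obtain s where s: "g = s @ y" "x = concat gs @ s"
    using g(1) by (auto simp: append_eq_append_conv2)
  show ?thesis
  proof (cases "s = []")
    case True
    then have "length gs = 1"
      using nyldon_concat_sorted[of gs] g s assms(1) by (auto simp: sorted_append)
    then have "x \<le> y" using g s True by (cases gs) auto
    then show ?thesis using assms(3) by simp
  next
    case False
    have "gs = []"
    proof (rule ccontr)
      assume "gs \<noteq> []"
      then have "concat gs \<noteq> []" using g(3) nyldon_not_Nil by (cases gs) auto
      then have "\<not> nyldon (s @ y)"
        using suf[of "concat gs @ _"] s(2) False assms(2)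
        by (intro nyldon_append_suffix_not_nyldon) auto
      then show False using g(2) s(1) by simp
    qed
    then show ?thesis using g by simp
  qed
qed


subsection \<open>Lazard elimination\<close>

text \<open>
  The comparison is weak, so that a single pair can be merged at a time: after merging \<open>x\<close> with the
  least letter \<open>y\<close>, the suffix \<open>y\<close> of \<open>xy\<close> may still occur as a letter itself.
\<close>

definition lazard_letters :: "nat list set \<Rightarrow> bool" where
  "lazard_letters G \<longleftrightarrow> (\<forall>x\<in>G. nyldon x) \<and>
     (\<forall>p s y. p \<noteq> [] \<longrightarrow> p @ s \<in> G \<longrightarrow> nyldon s \<longrightarrow> y \<in> G \<longrightarrow> s \<le> y)"

lemma lazard_letters_subset: "lazard_letters G \<Longrightarrow> H \<subseteq> G \<Longrightarrow> lazard_letters H"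
  unfolding lazard_letters_def by blast

text \<open>Suffixes of old letters are at most \<open>x \<le> x @ y\<close>. A Nyldon suffix of
  \<open>x @ y\<close> lies inside \<open>y\<close>, since \<open>r @ y\<close> with a nonempty
  proper suffix \<open>r\<close> of \<open>x\<close> is not Nyldon.\<close>

lemma lazard_letters_merge:
  assumes G: "lazard_letters G" and x: "x \<in> G" and y: "y \<in> G" "y \<noteq> x" and min: "\<forall>z\<in>G. y \<le> z"
    and H: "H \<subseteq> insert (x @ y) G"
  shows "lazard_letters H"
proof -
  have yx: "y < x" using y(2) min x by (meson order.not_eq_order_implies_strict)
  have ny: "nyldon x" "nyldon y" using G x y unfolding lazard_letters_def by auto
  have suf: "s \<le> y" if "x = p @ s" "p \<noteq> []" "nyldon s" for p s
    using G x y that unfolding lazard_letters_def by blast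
  have xy: "nyldon (x @ y)" using nyldon_append[OF ny yx] suf by blast
  have new: "s \<le> y" if s: "x @ y = p @ s" "p \<noteq> []" "nyldon s" for p s
  proof (cases "length s \<le> length y")
    case True
    then obtain e where e: "y = e @ s" using append_eq_append_suffix s(1) by blast
    then show ?thesis using nyldon_suffix_less[OF ny(2) e _ s(3)] by (cases "e = []") auto
  next
    case False
    then obtain r where r: "s = r @ y" "x = p @ r"
      using append_eq_append_longer[OF s(1)] by blast
    have "r \<noteq> []" using False r by auto
    then have "\<not> nyldon (r @ y)"
      using suf[of "p @ _"] r s(2) by (intro nyldon_append_suffix_not_nyldon[OF ny(2)]) auto
    then show ?thesis using s(3) r by simp
  qed
  have "lazard_letters (insert (x @ y) G)"
    unfolding lazard_letters_def
  proof (intro conjI ballI allI impI)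
    fix z assume "z \<in> insert (x @ y) G"
    then show "nyldon z" using xy G unfolding lazard_letters_def by auto
  next
    fix p s z assume a: "p \<noteq> []" "p @ s \<in> insert (x @ y) G" "nyldon s" "z \<in> insert (x @ y) G"
    have xxy: "x \<le> x @ y" by (rule le_append_list)
    show "s \<le> z"
    proof (cases "p @ s \<in> G")
      case True
      then have "s \<le> x" "z \<in> G \<Longrightarrow> s \<le> z"
        using G a x unfolding lazard_letters_def by blast+
      then show ?thesis using a(4) xxy by auto
    next
      case False
      then have "s \<le> y" using new[of p s] a by auto
      also have "y \<le> z" using a(4) min yx xxy by auto
      finally show ?thesis .
    qed
  qed
  then show ?thesis using H by (rule lazard_letters_subset)
qed

lemma adjacent_pair:
  "y \<in> set xs \<Longrightarrow> hd xs \<noteq> y \<Longrightarrow> \<exists>as x bs. xs = as @ x # y # bs \<and> x \<noteq> y"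
proof (induction xs)
  case (Cons a xs)
  then have xs: "y \<in> set xs" "a \<noteq> y" by auto
  show ?case
  proof (cases "hd xs = y")
    case True
    then have "a # xs = [] @ a # y # tl xs" using xs(1) by (cases xs) auto
    then show ?thesis using xs(2) by blast
  next
    case False
    then obtain as x bs where "xs = as @ x # y # bs" "x \<noteq> y" using Cons.IH xs(1) by blast
    then show ?thesis by (intro exI[of _ "a # as"]) auto
  qed
qed simp

text \<open>Each round removes a block: a least block in front is split off as a factor; otherwise
  one that follows a different block is merged into it. Merging only enlarges, so the bound
  \<open>a\<close> persists.\<close>

lemma lazard_letters_sort:
  assumes "lazard_letters (set xs)" "\<forall>x\<in>set xs. a \<le> x"
  shows "\<exists>fs. concat fs = concat xs \<and> (\<forall>f\<in>set fs. nyldon f \<and> a \<le> f) \<and> sorted fs"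
  using assms
proof (induction "length xs" arbitrary: xs a rule: less_induct)
  case less
  show ?case
  proof (cases xs)
    case Nil
    then show ?thesis by (intro exI[of _ "[]"]) simp
  next
    case (Cons b bs)
    define y where "y = Min (set xs)"
    have y: "y \<in> set xs" "\<forall>z\<in>set xs. y \<le> z" using Cons Min_in[of "set xs"] unfolding y_def by auto
    show ?thesis
    proof (cases "b = y")
      case True
      then obtain fs where fs: "concat fs = concat bs" "\<forall>f\<in>set fs. nyldon f \<and> y \<le> f" "sorted fs"
        using less(1)[of bs y] y(2) Cons lazard_letters_subset[OF less(2), of "set bs"] by auto
      have "nyldon y" "a \<le> y" using less(2,3) y(1) by (auto simp: lazard_letters_def)
      then show ?thesis using fs Cons True by (intro exI[of _ "y # fs"]) auto
    next
      case False
      then obtain as x cs where xs: "xs = as @ x # y # cs" "x \<noteq> y"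
        using adjacent_pair[of y xs] y(1) Cons by auto
      let ?xs = "as @ (x @ y) # cs"
      have "lazard_letters (set ?xs)"
        using xs y by (intro lazard_letters_merge[OF less(2), of x y]) auto
      moreover have "\<forall>z\<in>set ?xs. a \<le> z"
        using less(3) xs le_append_list[of x y] by auto
      ultimately show ?thesis using less(1)[of ?xs a] xs by auto
    qed
  qed
qed

text \<open>Sorting the blocks after the head yields factors not below the head, so a Nyldon word
  leaves nothing after it.\<close>

lemma lazard_letters_hd_min:
  assumes "lazard_letters (set xs)" "nyldon (concat xs)" "\<forall>x\<in>set xs. hd xs \<le> x" "xs \<noteq> []"
  shows "xs = [concat xs]"
proof -
  obtain a bs where xs: "xs = a # bs" using assms(4) by (cases xs) auto
  obtain fs where fs: "concat fs = concat bs" "\<forall>f\<in>set fs. nyldon f \<and> a \<le> f" "sorted fs"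
    using lazard_letters_sort[of bs a] lazard_letters_subset[OF assms(1), of "set bs"] assms(3) xs by auto
  have "length (a # fs) = 1"
    using assms(1,2) xs fs by (intro nyldon_concat_sorted) (auto simp: lazard_letters_def)
  then have "concat bs = []" using fs(1) by auto
  moreover have "\<forall>b\<in>set bs. b \<noteq> []" using assms(1) xs nyldon_not_Nil by (auto simp: lazard_letters_def)
  ultimately have "bs = []" by (cases bs) auto
  then show ?thesis using xs by simp
qed

text \<open>A larger letter \<open>a\<close> starts a suffix of \<open>n\<close> whose first factor
  begins with \<open>a\<close>. Its last factor is then at least \<open>[a] > n\<close>, against the
  suffix order.\<close>

lemma nyldon_hd_max:
  assumes "nyldon n" "a \<in> set n"
  shows "a \<le> hd n"
proof (rule ccontr)
  assume less: "\<not> a \<le> hd n"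
  obtain p z where n: "n = p @ a # z" using assms(2) by (meson split_list)
  have "p \<noteq> []" using n less by (cases p) auto
  obtain ws g where f: "nyldon_factorization (a # z) (ws @ [g])"
    using nyldon_factorization_snoc by blast
  then have g: "a # z = concat ws @ g" "nyldon g" "\<forall>u\<in>set ws. nyldon u" "sorted (ws @ [g])"
    by (auto simp: nyldon_factorization_def)
  have "\<exists>h t. h \<le> g \<and> h = a # t"
  proof (cases ws)
    case Nil then show ?thesis using g(1) by auto
  next
    case (Cons u us)
    then have "u \<le> g" "u \<noteq> []" using g(3,4) nyldon_not_Nil by auto
    then show ?thesis using g(1) Cons by (cases u) auto
  qed
  then have "[a] \<le> g" by (metis Cons_le_Cons Nil_le_Cons order_trans order_refl)
  moreover have "n < [a]" using less n \<open>p \<noteq> []\<close> by (cases p) auto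
  moreover have "g < n"
    using nyldon_suffix_less[OF assms(1), of "p @ concat ws" g] n g(1,2) \<open>p \<noteq> []\<close> by simp
  ultimately show False by simp
qed

subsection \<open>Parallel elimination in \<open>n\<close> and in \<open>n\<^sup>i v\<close>\<close>

text \<open>
  \<open>q @ r\<close> spells \<open>n\<close>, \<open>q @ t\<close> spells \<open>n\<^sup>i v\<close>. A block of \<open>n\<close> outside the common part \<open>q\<close> has already been
  merged since the last increase of \<open>i\<close>, except possibly the head of \<open>r\<close>; in that case the head of \<open>t\<close>
  properly extends it, hence is not minimal, so \<open>i\<close> cannot increase before the head of \<open>r\<close> is merged.
\<close>

definition parallel_blocks ::
  "nat list \<Rightarrow> nat list \<Rightarrow> nat \<Rightarrow> nat list list \<Rightarrow> nat list list \<Rightarrow> nat list list \<Rightarrow> bool" where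
  "parallel_blocks n v i q r t \<longleftrightarrow>
     lazard_letters (set q \<union> set r \<union> set t) \<and>
     concat (q @ r) = n \<and> concat (q @ t) = word_power n i @ v \<and>
     (\<forall>x\<in>set q \<union> set r. 2 ^ i \<le> length x) \<and>
     (i > 0 \<longrightarrow> (\<forall>x\<in>set (tl r). 2 ^ (i + 1) \<le> length x) \<and>
        (\<forall>x xs. r = x # xs \<longrightarrow> 2 ^ (i + 1) \<le> length x \<or>
            (\<exists>e ys. e \<noteq> [] \<and> t = (x @ e) # ys)))"

lemma parallel_blocks_step:
  assumes n: "nyldon n" and v: "v \<noteq> []" "hd v = hd n"
    and "parallel_blocks n v i q r t"
  shows "(\<exists>fs. concat fs = word_power n i @ v \<and> (\<forall>f\<in>set fs. nyldon f \<and> n \<le> f) \<and> sorted fs) \<or>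
         (\<exists>q r t. parallel_blocks n v (Suc i) q r t)"
  using assms(4)
\<comment> \<open>The blocks of both words are counted, those of \<open>q\<close> once for each
  word; every merge lowers the count.\<close>
proof (induction "2 * length q + length r + length t" arbitrary: q r t rule: less_induct)
  case less
  let ?G = "set q \<union> set r \<union> set t"
  note P = less.prems[unfolded parallel_blocks_def]
  have G: "lazard_letters ?G" and cn: "concat (q @ r) = n" and cv: "concat (q @ t) = word_power n i @ v"
    and len: "\<forall>x\<in>set q \<union> set r. 2 ^ i \<le> length x"
    using P by auto
  have tlr: "\<forall>x\<in>set (tl r). 2 ^ (i + 1) \<le> length x" if "i > 0" using P that by blast
  have hdr: "2 ^ (i + 1) \<le> length x \<or> (\<exists>e ys. e \<noteq> [] \<and> t = (x @ e) # ys)"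
    if "i > 0" "r = x # xs" for x xs using P that by blast
  have qr: "q @ r \<noteq> []" using cn nyldon_not_Nil[OF n] by auto
  define y where "y = Min ?G"
  have "?G \<noteq> {}" using qr by auto
  then have y: "y \<in> ?G" unfolding y_def by (intro Min_in) auto
  have ymin: "\<forall>z\<in>?G. y \<le> z" unfolding y_def by auto
  have merge: "lazard_letters H" if "x \<in> ?G" "x \<noteq> y" "H \<subseteq> insert (x @ y) ?G" for x H
    using lazard_letters_merge[OF G that(1) y _ ymin that(3)] that(2) by blast
  have yne: "y \<noteq> []" using G y nyldon_not_Nil by (auto simp: lazard_letters_def)
  show ?case
  proof (cases "hd (q @ r) = y")
    \<comment> \<open>With a least block at its head, \<open>n\<close> is a single block, and the
      blocks of the other word, all at least \<open>n\<close>, can be sorted.\<close>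
    case True
    have "q @ r = [concat (q @ r)]"
    proof (rule lazard_letters_hd_min)
      show "lazard_letters (set (q @ r))" using G by (rule lazard_letters_subset) auto
      show "\<forall>x\<in>set (q @ r). hd (q @ r) \<le> x" using True ymin by auto
    qed (use cn n qr in auto)
    then have "y = n" using True cn by (metis list.sel(1))
    then have "\<exists>fs. concat fs = concat (q @ t) \<and> (\<forall>f\<in>set fs. nyldon f \<and> n \<le> f) \<and> sorted fs"
      using ymin by (intro lazard_letters_sort lazard_letters_subset[OF G]) auto
    then show ?thesis using cv by auto
  next
    case hd: False
    \<comment> \<open>\<open>y\<close> merges with its left neighbour. In \<open>hdr\<close>, and in
      \<open>hdt\<close> with \<open>q\<close> nonempty, this is the last block of \<open>q\<close>,
      which leaves the common part.\<close>
    consider (q) "y \<in> set q" | (r) "y \<notin> set q" "y \<in> set r" "hd r \<noteq> y"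
      | (hdr) xs where "y \<notin> set q" "r = y # xs" | (t) "y \<in> set t" "hd t \<noteq> y"
      | (hdt) ys where "y \<notin> set q" "y \<notin> set r" "t = y # ys"
      using y by (metis Un_iff list.collapse list.set(1) empty_iff)
    then show ?thesis
    proof cases
      case q
      then have "hd q \<noteq> y" using hd by (cases q) auto
      then obtain as x bs where q': "q = as @ x # y # bs" "x \<noteq> y" using adjacent_pair[OF q] by blast
      have "parallel_blocks n v i (as @ (x @ y) # bs) r t"
        unfolding parallel_blocks_def
        apply (intro conjI impI)
        subgoal using q' by (intro merge[of x]) auto
        subgoal using cn q' by simp
        subgoal using cv q' by simp
        subgoal using len q' by auto
        subgoal using tlr by blast
        subgoal using hdr by blast
        done
      then show ?thesis by (rule less.hyps[rotated]) (simp add: q')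
    next
      case r
      then obtain as x bs where r': "r = as @ x # y # bs" "x \<noteq> y" using adjacent_pair[of y r] by blast
      have xl: "2 ^ (i + 1) \<le> length (x @ y)" using len r' by auto
      have "parallel_blocks n v i q (as @ (x @ y) # bs) t"
        unfolding parallel_blocks_def
        apply (intro conjI impI)
        subgoal using r' by (intro merge[of x]) auto
        subgoal using cn r' by simp
        subgoal using cv by simp
        subgoal using len r' by auto
        subgoal using tlr r' xl by (cases as) auto
        subgoal using hdr r' xl by (cases as) auto
        done
      then show ?thesis by (rule less.hyps[rotated]) (simp add: r')
    next
      case hdr': hdr
      then have "q \<noteq> []" using hd by auto
      then obtain q' z where q': "q = q' @ [z]" by (metis rev_exhaust)
      have "z \<noteq> y" using hdr' q' by auto
      have xl: "2 ^ (i + 1) \<le> length (z @ y)" using len q' hdr' by auto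
      have "parallel_blocks n v i q' ((z @ y) # xs) (z # t)"
        unfolding parallel_blocks_def
        apply (intro conjI impI)
        subgoal using q' hdr' \<open>z \<noteq> y\<close> by (intro merge[of z]) auto
        subgoal using cn q' hdr' by simp
        subgoal using cv q' by simp
        subgoal using len q' hdr' by auto
        subgoal using tlr hdr' by auto
        subgoal using xl by auto
        done
      then show ?thesis by (rule less.hyps[rotated]) (simp add: q' hdr')
    next
      case t
      then obtain as x bs where t': "t = as @ x # y # bs" "x \<noteq> y" using adjacent_pair[of y t] by blast
      have "parallel_blocks n v i q r (as @ (x @ y) # bs)"
        unfolding parallel_blocks_def
      proof (intro conjI allI impI)
        show "lazard_letters (set q \<union> set r \<union> set (as @ (x @ y) # bs))"
          using t' by (intro merge[of x]) auto
        \<comment> \<open>A merge keeps or extends the head of \<open>t\<close>.\<close>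
        fix z zs assume "i > 0" "r = z # zs"
        then consider "2 ^ (i + 1) \<le> length z" | e ys where "e \<noteq> []" "t = (z @ e) # ys"
          using hdr by blast
        then show "2 ^ (i + 1) \<le> length z \<or> (\<exists>e ys. e \<noteq> [] \<and> as @ (x @ y) # bs = (z @ e) # ys)"
        proof cases
          case 2
          then show ?thesis using t' by (cases as) auto
        qed simp
      qed (use cn cv len tlr t' in auto)
      then show ?thesis by (rule less.hyps[rotated]) (simp add: t')
    next
      case hdt
      have rlen: "\<forall>x\<in>set r. 2 ^ (i + 1) \<le> length x" if i: "i > 0"
      proof (cases r)
        case (Cons x xs)
        have "2 ^ (i + 1) \<le> length x"
        proof (rule ccontr)
          assume "\<not> ?thesis"
          then obtain e where "e \<noteq> []" "y = x @ e" using hdr[OF i Cons] hdt by auto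
          then have "x < y" using less_append_list by blast
          then show False using ymin Cons by (auto simp: not_le[symmetric])
        qed
        then show ?thesis using tlr[OF i] Cons by auto
      qed simp
      show ?thesis
      proof (cases q rule: rev_cases)
        case (snoc q' z)
        have "z \<noteq> y" using hdt snoc by auto
        \<comment> \<open>\<open>z\<close> may be a short head of \<open>r\<close>: the permitted
          exception, as \<open>t\<close> now starts with \<open>z @ y\<close>.\<close>
        have "parallel_blocks n v i q' (z # r) ((z @ y) # ys)"
          unfolding parallel_blocks_def
          apply (intro conjI impI)
          subgoal using snoc hdt \<open>z \<noteq> y\<close> by (intro merge[of z]) auto
          subgoal using cn snoc by simp
          subgoal using cv snoc hdt by simp
          subgoal using len snoc by auto
          subgoal using rlen by auto
          subgoal using yne by auto
          done
        then show ?thesis by (rule less.hyps[rotated]) (simp add: snoc hdt)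
      next
        case Nil
        \<comment> \<open>For \<open>i = 0\<close>: \<open>y\<close> begins with the largest letter of \<open>n\<close> and is not a block of \<open>n\<close>, so no
          single letter is left as a block of \<open>n\<close>.\<close>
        have rl: "2 ^ (i + 1) \<le> length x" if x: "x \<in> set r" for x
        proof (cases "i = 0")
          case True
          have "length x \<noteq> 1"
          proof
            assume "length x = 1"
            then obtain a where a: "x = [a]" by (auto simp: length_Suc_conv)
            have "a \<in> set n" using cn x a Nil by (force intro!: bexI[of _ x])
            then have "a \<le> hd n" using nyldon_hd_max n by blast
            moreover have "hd y = hd n"
              using arg_cong[OF cv, of hd] hdt(3) Nil True v yne by (simp add: word_power_def)
            moreover have "y \<le> [a]" "y \<noteq> [a]" using ymin x a hdt by auto
            ultimately show False using yne by (cases y) auto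
          qed
          moreover have "1 \<le> length x" using len x True by auto
          ultimately show ?thesis using True by simp
        qed (use rlen x in auto)
        obtain q' z where r': "r = q' @ [z]" using qr Nil by (metis append_Nil rev_exhaust)
        have "z \<noteq> y" using hdt r' by auto
        \<comment> \<open>The last block \<open>z\<close> of the new copy of \<open>n\<close> merges
          with \<open>y\<close>; its other blocks form the new common part.\<close>
        have "parallel_blocks n v (Suc i) q' [z] ((z @ y) # ys)"
          unfolding parallel_blocks_def
          apply (intro conjI impI)
          subgoal using r' hdt \<open>z \<noteq> y\<close> by (intro merge[of z]) auto
          subgoal using cn r' Nil by simp
          subgoal using cn cv r' hdt Nil by (auto simp: word_power_Suc)
          subgoal using rl r' by auto
          subgoal by simp
          subgoal using yne by auto
          done
        then show ?thesis by blast
      qed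
    qed
  qed
qed

lemma parallel_blocks_bound:
  assumes "parallel_blocks n v i q r t" "nyldon n"
  shows "2 ^ i \<le> length n"
proof -
  have n: "concat (q @ r) = n" and len: "\<forall>x\<in>set (q @ r). 2 ^ i \<le> length x"
    using assms(1) by (auto simp: parallel_blocks_def)
  have "q @ r \<noteq> []" using n nyldon_not_Nil[OF assms(2)] by auto
  then obtain x xs where xs: "q @ r = x # xs" by (meson neq_Nil_conv)
  have "length x \<le> length n" using n unfolding xs by auto
  then show ?thesis using len xs by fastforce
qed

text \<open>Every stuck elimination raises \<open>i\<close>, and \<open>2 ^ i \<le> length n\<close>
  bounds how often this can happen.\<close>

lemma nyldon_power_prefix_factorization:
  assumes n: "nyldon n" "n = v @ u" and v: "v \<noteq> []"
  shows "\<exists>i fs. 2 ^ i \<le> length n \<and> concat fs = word_power n i @ v \<and>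
           (\<forall>f\<in>set fs. nyldon f \<and> n \<le> f) \<and> sorted fs"
proof -
  have run: ?thesis if "parallel_blocks n v i q r t" for i q r t
    using that
  proof (induction "length n - i" arbitrary: i q r t rule: less_induct)
    case less
    have b: "2 ^ i \<le> length n" using parallel_blocks_bound less.prems n(1) by blast
    have "hd v = hd n" using n(2) v by simp
    then consider (final) "\<exists>fs. concat fs = word_power n i @ v \<and> (\<forall>f\<in>set fs. nyldon f \<and> n \<le> f) \<and> sorted fs"
      | (loss) q' r' t' where "parallel_blocks n v (Suc i) q' r' t'"
      using parallel_blocks_step[OF n(1) v _ less.prems] by blast
    then show ?case
    proof cases
      case final
      then show ?thesis using b by blast
    next
      case loss
      have "i < length n" using b less_exp[of i] by linarith
      then have "length n - Suc i < length n - i" by simp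
      then show ?thesis using less.hyps loss by blast
    qed
  qed
  have sing: "concat (map (\<lambda>a. [a]) x) = x" for x :: "nat list" by (induction x) auto
  have "lazard_letters (range (\<lambda>a. [a]))"
    unfolding lazard_letters_def
    by (auto simp: nyldon_singleton append_eq_Cons_conv dest: nyldon_not_Nil)
  \<comment> \<open>Initially all blocks are single letters; for \<open>i = 0\<close> the second
    word is \<open>v\<close>, a prefix of \<open>n\<close>, hence the common part.\<close>
  then have "parallel_blocks n v 0 (map (\<lambda>a. [a]) v) (map (\<lambda>a. [a]) u) []"
    unfolding parallel_blocks_def
    using n(2) by (auto simp: sing word_power_def intro: lazard_letters_subset)
  then show ?thesis by (rule run)
qed

section \<open>Factorization of the powers of \<open>w\<close>\<close>

lemma word_power_conjugate: "word_power (u @ v) (Suc k) = u @ word_power (v @ u) k @ v"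
  by (induction k) (simp_all add: word_power_def)

theorem theorem4p6:
  fixes m K :: nat and w n :: "nat list"
  assumes "m \<ge> 1"
    and "w \<in> lists {0..m}" and "w \<noteq> []"
    and "primitive_word w"
    and "nyldon n" and "conjugate_word n w"
    and "K = nat \<lfloor>log 2 (real (length w))\<rfloor> + 1"
  shows "\<exists>N. \<forall>k\<ge>N.
           \<exists>ps ss. nyldon_factorization (word_power w k) (ps @ replicate (k - K) n @ ss)"
proof -
  obtain u v where uv: "w = u @ v" "n = v @ u" "v \<noteq> []"
    using assms(3,6) unfolding conjugate_word_def by (metis append_Nil append_Nil2)
  obtain i fs where i: "2 ^ i \<le> length n"
    and fs: "concat fs = word_power n i @ v" "\<forall>f\<in>set fs. nyldon f \<and> n \<le> f" "sorted fs"
    using nyldon_power_prefix_factorization[OF assms(5) uv(2,3)] by blast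
  have "length n = length w" using uv by simp
  then have "real i \<le> log 2 (length w)"
    using i assms(3) by (subst le_log_iff) (auto simp: powr_realpow simp flip: of_nat_power)
  then have iK: "i < K" unfolding assms(7) by linarith
  obtain ps where ps: "concat ps = u" "\<forall>p\<in>set ps. nyldon p \<and> p \<le> n" "sorted ps"
  proof (cases "u = []")
    case True
    then show ?thesis using that[of "[]"] by simp
  next
    case False
    obtain ws g where f: "nyldon_factorization u (ws @ [g])"
      using nyldon_factorization_snoc False by blast
    then have g: "u = concat ws @ g" "nyldon g" "\<forall>p\<in>set ws. nyldon p \<and> p \<le> g" "sorted (ws @ [g])"
      by (auto simp: nyldon_factorization_def sorted_append)
    \<comment> \<open>\<open>g\<close> is a suffix of \<open>n = v @ u\<close>, proper because
      \<open>v\<close> is nonempty.\<close>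
    have "g < n" using nyldon_suffix_less[OF assms(5), of "v @ concat ws" g] g uv by simp
    then show ?thesis using that[of "ws @ [g]"] g by fastforce
  qed
  \<comment> \<open>Between \<open>u\<close> and \<open>v\<close> stand \<open>k - 1\<close> copies
    of \<open>n\<close>: \<open>k - K\<close> form the run, the last \<open>i\<close> are absorbed
    in \<open>fs\<close>, and the other \<open>K - 1 - i\<close> are counted among the right-hand
    factors.\<close>
  have "nyldon_factorization (word_power w k) (ps @ replicate (k - K) n @ replicate (K - 1 - i) n @ fs)"
    if "k \<ge> K" for k
  proof -
    define k' where "k' = k - 1"
    have k': "k = Suc k'" using that iK unfolding k'_def by linarith
    have k'': "k' = (k - K) + (K - 1 - i) + i" using that iK unfolding k'_def by linarith
    have "word_power n k' = concat (replicate (k - K) n) @ concat (replicate (K - 1 - i) n) @ word_power n i"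
      unfolding word_power_def by (subst k'') (simp only: replicate_add concat_append append_assoc)
    then have "word_power w k = concat (ps @ replicate (k - K) n @ replicate (K - 1 - i) n @ fs)"
      using word_power_conjugate[of u v k'] ps(1) fs(1) k' uv(1) by (simp flip: uv(2))
    moreover have "sorted (ps @ replicate (k - K) n @ replicate (K - 1 - i) n @ fs)"
      using ps fs by (fastforce simp: sorted_append)
    moreover have "fs \<noteq> []" using fs(1) uv(3) by auto
    ultimately show ?thesis
      using ps(2) fs(2) assms(5) unfolding nyldon_factorization_def by auto
  qed
  then show ?thesis by blast
qed

end
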